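(* The fractional local search algorithm described in the context returns $x\in\mathcal{R}$ such that $$F(\phi(x))\ \ge\ (1-o(1))\,\max\{F(y): y\in\mathcal{P}\},$$ where $o(1)$ refers to the number of bins $n\to\infty$.
   Context: Generalized assignment problem: bins $I=\{1,\dots,n\}$, items $J=\{1,\dots,m\}$; bin $i$ has value $v_{ij}\ge0$ and weight $w_{ij}$ for item $j$, and capacity $C_i$. $\mathcal{F}_i=\{S\subseteq J:\sum_{j\in S}w_{ij}\le C_i\}$ is the collection of feasible sets for bin $i$. $M=\max\{v_{ij}:i\in I,j\in J\}$. $\mathcal{R}$ is the set of all $x=(x_{i,S})\in[0,1]^{I\times 2^J}$ with $\sum_{S\in\mathcal{F}_i}x_{i,S}\le1$ for every $i\in I$ and $x_{i,S}\ge0$ for every $i\in I$, $S\in\mathcal{F}_i$. Define $\phi:\mathcal{R}\to[0,1]^{I\times J}$ by $\phi(x)_{ij}=\sum_{S\in\mathcal{F}_i:\, j\in S}x_{i,S}$, and $\mathcal{P}=\{y\in[0,1]^{I\times J}: y=\phi(x),\ x\in\mathcal{R}\}$. For each item $j$ let $\sigma_j$ be a permutation of $I$ such that $v_{\sigma_j(i),j}$ is non-increasing as $i$ runs from $1$ to $n$, with the convention $v_{\sigma_j(n+1),j}=0$, and $$F(y)=\sum_{j=1}^m\sum_{i=1}^n\big(v_{\sigma_j(i),j}-v_{\sigma_j(i+1),j}\big)\Big(1-\exp\big(-\sum_{k=1}^i y_{\sigma_j(k),j}\big)\Big).$$ For $u_i=(u_{ij})_{j\in J}$ and $0<\epsilon<1$,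 $\mathrm{KnapsackFptas}(u_i,\epsilon)$ denotes a subroutine returning some $S\in\mathcal{F}_i$ with $\sum_{j\in S}u_{ij}\ge(1-\epsilon)\max\{\sum_{j\in T}u_{ij}:T\in\mathcal{F}_i\}$. Fractional local search algorithm, with input $v=(v_{ij})$ and $0<\epsilon\le1/n$: Step 0: set $x:=\vec0\in[0,1]^{I\times 2^J}$, $y:=\vec0\in[0,1]^{I\times J}$, $\mathcal{Z}:=\emptyset$, $\delta:=\epsilon/(6mn^2)$. Step 1: $u:=\nabla F(y)$, $z:=\vec 0\in[0,1]^{I\times J}$. Step 2: for each bin $i$, let $S:=\mathrm{KnapsackFptas}(u_i,\epsilon)$ and set $z_{ij}:=1$ for all $j\in S$. Step 3: if $(z-y)\cdot\nabla F(y)>\epsilon M$, then: if $|\mathcal{Z}|<1/\delta$, update $y:=y+\delta z$ and $\mathcal{Z}:=\mathcal{Z}\cup\{z\}$; else update $y:=y+\delta(z-z^{\min})$, where $z^{\min}=\arg\min_{z'\in\mathcal{Z}}z'\cdot u$, and $\mathcal{Z}:=(\mathcal{Z}\setminus\{z^{\min}\})\cup\{z\}$; then go back to Step 1. If the condition fails, go to Step 4. Step 4: for each $z\in\mathcal{Z}$ and each bin $i$, update $x_{i,S}:=x_{i,S}+\delta$, where $S=\{j:z_{ij}=1\}$. Return $x$.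
   Formalization: The collection Z is counted with multiplicity (also in |Z| and Step 4), the test |Z| < 1/δ is read as |Z| < ⌊1/δ⌋, and it is assumed that some item j with v_ij = M fits alone into its bin i; without these the claim fails. *)

theory Defs
  imports
    "HOL-Analysis.Analysis"
    "HOL-Library.Multiset"
    "HOL-Library.Landau_Symbols"
    "HOL-Library.While_Combinator"
    "HOL-Combinatorics.Permutations"
begin

text \<open>
  Bins are \<open>{1..n}\<close> and items are \<open>{1..m}\<close>.  A vector indexed by bins and items is a function
  \<open>nat \<Rightarrow> nat \<Rightarrow> real\<close>, a vector indexed by bins and item sets is a function
  \<open>nat \<Rightarrow> nat set \<Rightarrow> real\<close>; entries outside the index range are never constrained and never
  influence the objective.
\<close>

definition feasible_sets :: "nat \<Rightarrow> (nat \<Rightarrow> nat \<Rightarrow> real) \<Rightarrow> (nat \<Rightarrow> real) \<Rightarrow> nat \<Rightarrow> nat set set" where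
  "feasible_sets m w C i = {S. S \<subseteq> {1..m} \<and> (\<Sum>j\<in>S. w i j) \<le> C i}"

definition max_value :: "nat \<Rightarrow> nat \<Rightarrow> (nat \<Rightarrow> nat \<Rightarrow> real) \<Rightarrow> real" where
  "max_value n m v = Max {v i j | i j. i \<in> {1..n} \<and> j \<in> {1..m}}"

definition config_polytope ::
  "nat \<Rightarrow> nat \<Rightarrow> (nat \<Rightarrow> nat \<Rightarrow> real) \<Rightarrow> (nat \<Rightarrow> real) \<Rightarrow> (nat \<Rightarrow> nat set \<Rightarrow> real) set" where
  "config_polytope n m w C =
     {x. (\<forall>i\<in>{1..n}. \<forall>S\<in>Pow {1..m}. x i S \<in> {0..1}) \<and>
         (\<forall>i\<in>{1..n}. (\<Sum>S\<in>feasible_sets m w C i. x i S) \<le> 1) \<and>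
         (\<forall>i\<in>{1..n}. \<forall>S\<in>feasible_sets m w C i. x i S \<ge> 0)}"

definition marginals ::
  "nat \<Rightarrow> (nat \<Rightarrow> nat \<Rightarrow> real) \<Rightarrow> (nat \<Rightarrow> real) \<Rightarrow> (nat \<Rightarrow> nat set \<Rightarrow> real) \<Rightarrow> nat \<Rightarrow> nat \<Rightarrow> real" where
  "marginals m w C x = (\<lambda>i j. \<Sum>S | S \<in> feasible_sets m w C i \<and> j \<in> S. x i S)"

definition marginal_polytope ::
  "nat \<Rightarrow> nat \<Rightarrow> (nat \<Rightarrow> nat \<Rightarrow> real) \<Rightarrow> (nat \<Rightarrow> real) \<Rightarrow> (nat \<Rightarrow> nat \<Rightarrow> real) set" where
  "marginal_polytope n m w C =
     {y. (\<forall>i\<in>{1..n}. \<forall>j\<in>{1..m}. y i j \<in> {0..1}) \<and>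
         (\<exists>x\<in>config_polytope n m w C. y = marginals m w C x)}"

definition value_order :: "nat \<Rightarrow> nat \<Rightarrow> (nat \<Rightarrow> nat \<Rightarrow> real) \<Rightarrow> (nat \<Rightarrow> nat \<Rightarrow> nat) \<Rightarrow> bool" where
  "value_order n m v \<sigma> \<longleftrightarrow>
     (\<forall>j\<in>{1..m}. \<sigma> j permutes {1..n} \<and> antimono_on {1..n} (\<lambda>i. v (\<sigma> j i) j))"

text \<open>The value at sorted position \<open>i\<close>, with the convention that it is zero at position \<open>n + 1\<close>.\<close>

definition sorted_value ::
  "nat \<Rightarrow> (nat \<Rightarrow> nat \<Rightarrow> real) \<Rightarrow> (nat \<Rightarrow> nat \<Rightarrow> nat) \<Rightarrow> nat \<Rightarrow> nat \<Rightarrow> real" where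
  "sorted_value n v \<sigma> j i = (if i \<le> n then v (\<sigma> j i) j else 0)"

definition objective ::
  "nat \<Rightarrow> nat \<Rightarrow> (nat \<Rightarrow> nat \<Rightarrow> real) \<Rightarrow> (nat \<Rightarrow> nat \<Rightarrow> nat) \<Rightarrow> (nat \<Rightarrow> nat \<Rightarrow> real) \<Rightarrow> real" where
  "objective n m v \<sigma> y =
     (\<Sum>j=1..m. \<Sum>i=1..n. (sorted_value n v \<sigma> j i - sorted_value n v \<sigma> j (i + 1)) *
        (1 - exp (- (\<Sum>k=1..i. y (\<sigma> j k) j))))"

definition objective_gradient ::
  "nat \<Rightarrow> nat \<Rightarrow> (nat \<Rightarrow> nat \<Rightarrow> real) \<Rightarrow> (nat \<Rightarrow> nat \<Rightarrow> nat) \<Rightarrow> (nat \<Rightarrow> nat \<Rightarrow> real) \<Rightarrow> nat \<Rightarrow> nat \<Rightarrow> real" where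
  "objective_gradient n m v \<sigma> y =
     (\<lambda>i j. deriv (\<lambda>t. objective n m v \<sigma> (y(i := (y i)(j := t)))) (y i j))"

definition dot :: "nat \<Rightarrow> nat \<Rightarrow> (nat \<Rightarrow> nat \<Rightarrow> real) \<Rightarrow> (nat \<Rightarrow> nat \<Rightarrow> real) \<Rightarrow> real" where
  "dot n m a b = (\<Sum>i=1..n. \<Sum>j=1..m. a i j * b i j)"

text \<open>
  The specification is only required for non-negative profits: gradients of the objective are
  non-negative, and for negative profits a multiplicative guarantee need not be satisfiable.
\<close>

definition is_knapsack_fptas ::
  "nat \<Rightarrow> nat \<Rightarrow> (nat \<Rightarrow> nat \<Rightarrow> real) \<Rightarrow> (nat \<Rightarrow> real) \<Rightarrow>
   (nat \<Rightarrow> (nat \<Rightarrow> real) \<Rightarrow> real \<Rightarrow> nat set) \<Rightarrow> bool" where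
  "is_knapsack_fptas n m w C knapsack \<longleftrightarrow>
     (\<forall>i\<in>{1..n}. \<forall>u \<epsilon>. (\<forall>j\<in>{1..m}. 0 \<le> u j) \<and> 0 < \<epsilon> \<and> \<epsilon> < 1 \<longrightarrow>
        knapsack i u \<epsilon> \<in> feasible_sets m w C i \<and>
        (\<Sum>j\<in>knapsack i u \<epsilon>. u j) \<ge> (1 - \<epsilon>) * Max {\<Sum>j\<in>T. u j | T. T \<in> feasible_sets m w C i})"

definition step_size :: "nat \<Rightarrow> nat \<Rightarrow> real \<Rightarrow> real" where
  "step_size n m \<epsilon> = \<epsilon> / (6 * real m * (real n)\<^sup>2)"

definition search_point ::
  "nat \<Rightarrow> (nat \<Rightarrow> (nat \<Rightarrow> real) \<Rightarrow> real \<Rightarrow> nat set) \<Rightarrow> real \<Rightarrow> (nat \<Rightarrow> nat \<Rightarrow> real) \<Rightarrow> nat \<Rightarrow> nat \<Rightarrow> real" where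
  "search_point n knapsack \<epsilon> u =
     (\<lambda>i j. if i \<in> {1..n} \<and> j \<in> knapsack i (u i) \<epsilon> then 1 else 0)"

text \<open>
  The loop state is \<open>(y, Z)\<close>.  The collection \<open>Z\<close> is a multiset: the same point may be produced in
  several rounds, and the algorithm relies on \<open>y\<close> being the step size times the sum of all points
  of \<open>Z\<close>, counted with multiplicity.
\<close>

definition search_continues ::
  "nat \<Rightarrow> nat \<Rightarrow> (nat \<Rightarrow> nat \<Rightarrow> real) \<Rightarrow> (nat \<Rightarrow> nat \<Rightarrow> nat) \<Rightarrow>
   (nat \<Rightarrow> (nat \<Rightarrow> real) \<Rightarrow> real \<Rightarrow> nat set) \<Rightarrow> real \<Rightarrow>
   (nat \<Rightarrow> nat \<Rightarrow> real) \<times> (nat \<Rightarrow> nat \<Rightarrow> real) multiset \<Rightarrow> bool" where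
  "search_continues n m v \<sigma> knapsack \<epsilon> = (\<lambda>(y, Z).
     let u = objective_gradient n m v \<sigma> y;
         z = search_point n knapsack \<epsilon> u
     in dot n m (\<lambda>i j. z i j - y i j) u > \<epsilon> * max_value n m v)"

text \<open>
  \<open>Z\<close> offers \<open>1 / \<delta>\<close> slots.  When \<open>1 / \<delta>\<close> is not an integer this is rounded down, since a further
  point would make the total weight \<open>\<delta> * size Z\<close> put on a bin exceed one; for integral \<open>1 / \<delta>\<close>
  the test below is just \<open>size Z < 1 / \<delta>\<close>.
\<close>

definition search_step ::
  "nat \<Rightarrow> nat \<Rightarrow> (nat \<Rightarrow> nat \<Rightarrow> real) \<Rightarrow> (nat \<Rightarrow> nat \<Rightarrow> nat) \<Rightarrow>
   (nat \<Rightarrow> (nat \<Rightarrow> real) \<Rightarrow> real \<Rightarrow> nat set) \<Rightarrow> real \<Rightarrow>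
   (nat \<Rightarrow> nat \<Rightarrow> real) \<times> (nat \<Rightarrow> nat \<Rightarrow> real) multiset \<Rightarrow>
   (nat \<Rightarrow> nat \<Rightarrow> real) \<times> (nat \<Rightarrow> nat \<Rightarrow> real) multiset" where
  "search_step n m v \<sigma> knapsack \<epsilon> = (\<lambda>(y, Z).
     let \<delta> = step_size n m \<epsilon>;
         u = objective_gradient n m v \<sigma> y;
         z = search_point n knapsack \<epsilon> u
     in if int (size Z) < \<lfloor>1 / \<delta>\<rfloor>
        then (\<lambda>i j. y i j + \<delta> * z i j, add_mset z Z)
        else let zmin = arg_min_on (\<lambda>z'. dot n m z' u) (set_mset Z)
             in (\<lambda>i j. y i j + \<delta> * (z i j - zmin i j), add_mset z (Z - {#zmin#})))"

definition extract_configs ::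
  "nat \<Rightarrow> nat \<Rightarrow> real \<Rightarrow> (nat \<Rightarrow> nat \<Rightarrow> real) multiset \<Rightarrow> nat \<Rightarrow> nat set \<Rightarrow> real" where
  "extract_configs n m \<delta> Z =
     (\<lambda>i S. \<Sum>z\<in>#Z. if i \<in> {1..n} \<and> S = {j \<in> {1..m}. z i j = 1} then \<delta> else 0)"

text \<open>The result is \<open>None\<close> exactly if the loop does not terminate.\<close>

definition fractional_local_search ::
  "nat \<Rightarrow> nat \<Rightarrow> (nat \<Rightarrow> nat \<Rightarrow> real) \<Rightarrow> (nat \<Rightarrow> nat \<Rightarrow> nat) \<Rightarrow>
   (nat \<Rightarrow> (nat \<Rightarrow> real) \<Rightarrow> real \<Rightarrow> nat set) \<Rightarrow> real \<Rightarrow> (nat \<Rightarrow> nat set \<Rightarrow> real) option" where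
  "fractional_local_search n m v \<sigma> knapsack \<epsilon> =
     map_option (\<lambda>(y, Z). extract_configs n m (step_size n m \<epsilon>) Z)
       (while_option (search_continues n m v \<sigma> knapsack \<epsilon>) (search_step n m v \<sigma> knapsack \<epsilon>)
          (\<lambda>i j. 0, {#}))"

end

theory Submission
  imports Defs
begin

text \<open>
  Write \<open>u = \<nabla>F(y)\<close> and let \<open>M\<close> be the largest value. The second-order error of a step of length \<open>\<delta>\<close>
  is at most \<open>m M (\<delta> n)\<^sup>2 = \<delta> \<epsilon> M / 6\<close>, and replacing \<open>y\<close> by the worst point of \<open>Z\<close>
  in the stopping test costs at most another \<open>\<epsilon> M / 6\<close>. Every round therefore raises \<open>F\<close> by at least
  \<open>\<delta> \<epsilon> M / 2\<close>, while \<open>F \<le> m M\<close>, so the loop terminates. On termination, concavity of \<open>F\<close>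
  gives \<open>F(y) \<ge> (1 - \<epsilon>) F(t) - \<epsilon> M\<close> for every \<open>t\<close> of the polytope. A single item placed
  alone in the bin attaining \<open>M\<close> shows \<open>M \<le> 2 OPT\<close>, so \<open>F(y) \<ge> (1 - 3 \<epsilon>) OPT\<close> and \<open>3 / n\<close>
  serves as the vanishing error.
\<close>

section \<open>Elementary inequalities and finite sums\<close>

text \<open>Controls the second-order remainder of a step in \<open>F_ascent\<close>, where the
  exponent may have either sign.\<close>

lemma exp_le_quadratic:
  fixes x :: real
  assumes "\<bar>x\<bar> \<le> 1"
  shows "exp x \<le> 1 + x + x\<^sup>2"
proof (cases "0 \<le> x")
  case True
  then show ?thesis using assms exp_bound[of x] by simp
next
  case False
  define a where "a = - x"
  have a: "a > 0" using False by (simp add: a_def)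
  \<comment> \<open>The product is \<open>1 + a ^ 3\<close>; together with
    \<open>1 + a \<le> exp a\<close> it gives the bound after division by
    \<open>exp a\<close>.\<close>
  have "1 \<le> (1 - a + a\<^sup>2) * (1 + a)"
    using a by (simp add: algebra_simps power2_eq_square)
  also have "\<dots> \<le> (1 - a + a\<^sup>2) * exp a"
  proof (rule mult_left_mono)
    show "0 \<le> 1 - a + a\<^sup>2"
      using assms by (simp add: a_def)
  qed simp
  finally have "exp (- a) * 1 \<le> exp (- a) * ((1 - a + a\<^sup>2) * exp a)"
    by (intro mult_left_mono) auto
  then have "exp (- a) \<le> 1 - a + a\<^sup>2"
    by (simp add: exp_minus field_simps)
  then show ?thesis by (simp add: a_def)
qed

lemma sum_sum_mset_swap:
  fixes f :: "'a \<Rightarrow> 'b \<Rightarrow> 'c::comm_monoid_add"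
  shows "(\<Sum>x\<in>A. \<Sum>z\<in>#Z. f x z) = (\<Sum>z\<in>#Z. \<Sum>x\<in>A. f x z)"
  by (induction Z) (simp_all add: sum.distrib)

lemma size_mult_le_sum_mset:
  fixes f :: "'a \<Rightarrow> real"
  assumes "\<And>z. z \<in># Z \<Longrightarrow> c \<le> f z"
  shows "real (size Z) * c \<le> (\<Sum>z\<in>#Z. f z)"
  using assms
proof (induction Z)
  case (add z Z)
  then have "c \<le> f z" "real (size Z) * c \<le> (\<Sum>z\<in>#Z. f z)" by auto
  then show ?case by (simp add: algebra_simps)
qed simp

lemma dot_add_left: "dot n m (\<lambda>i j. a i j + b i j) u = dot n m a u + dot n m b u"
  by (simp add: dot_def algebra_simps sum.distrib)

lemma dot_diff_left: "dot n m (\<lambda>i j. a i j - b i j) u = dot n m a u - dot n m b u"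
  by (simp add: dot_def algebra_simps sum_subtractf)

lemma dot_scale_left: "dot n m (\<lambda>i j. c * a i j) u = c * dot n m a u"
  by (simp add: dot_def algebra_simps sum_distrib_left)

lemma dot_sum_mset_left:
  "dot n m (\<lambda>i j. \<Sum>z\<in>#Z. z i j) u = (\<Sum>z\<in>#Z. dot n m z u)"
proof (induction Z)
  case (add x Z)
  then show ?case by (simp add: dot_add_left)
qed (simp add: dot_def)

lemma finite_feasible_sets [simp]: "finite (feasible_sets m w C i)"
  by (rule finite_subset[of _ "Pow {1..m}"]) (auto simp: feasible_sets_def)

section \<open>The objective as a nonnegative combination of functions of prefix loads\<close>

locale ordered_values =
  fixes n m :: nat and v :: "nat \<Rightarrow> nat \<Rightarrow> real" and \<sigma> :: "nat \<Rightarrow> nat \<Rightarrow> nat"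
  assumes n_pos: "1 \<le> n" and m_pos: "1 \<le> m"
    and v_nonneg: "\<And>i j. i \<in> {1..n} \<Longrightarrow> j \<in> {1..m} \<Longrightarrow> 0 \<le> v i j"
    and order: "value_order n m v \<sigma>"
begin

abbreviation "M \<equiv> max_value n m v"
abbreviation "F \<equiv> objective n m v \<sigma>"
abbreviation "grad \<equiv> objective_gradient n m v \<sigma>"
abbreviation "ip \<equiv> dot n m"

text \<open>With these coefficients \<open>F\<close> is a nonnegative combination of the concave
  functions \<open>1 - exp (- load)\<close>, so estimates on \<open>F\<close> and its gradient
  reduce to estimates for a single pair of item and position.\<close>

definition gap :: "nat \<Rightarrow> nat \<Rightarrow> real" where
  "gap j p = sorted_value n v \<sigma> j p - sorted_value n v \<sigma> j (p + 1)"

definition load :: "(nat \<Rightarrow> nat \<Rightarrow> real) \<Rightarrow> nat \<Rightarrow> nat \<Rightarrow> real" where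
  "load y j p = (\<Sum>k=1..p. y (\<sigma> j k) j)"

lemma F_eq: "F y = (\<Sum>j=1..m. \<Sum>p=1..n. gap j p * (1 - exp (- load y j p)))"
  by (simp add: objective_def gap_def load_def)

lemma \<sigma>_permutes: "j \<in> {1..m} \<Longrightarrow> \<sigma> j permutes {1..n}"
  using order by (simp add: value_order_def)

lemma \<sigma>_in: "j \<in> {1..m} \<Longrightarrow> k \<in> {1..n} \<Longrightarrow> \<sigma> j k \<in> {1..n}"
  using permutes_in_image[OF \<sigma>_permutes] by simp

lemma v_le_max: "i \<in> {1..n} \<Longrightarrow> j \<in> {1..m} \<Longrightarrow> v i j \<le> M"
proof -
  assume "i \<in> {1..n}" "j \<in> {1..m}"
  moreover have "{v i j |i j. i \<in> {1..n} \<and> j \<in> {1..m}} = (\<lambda>(i, j). v i j) ` ({1..n} \<times> {1..m})"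
    by force
  ultimately show ?thesis
    unfolding max_value_def by (intro Max_ge) auto
qed

lemma max_nonneg: "0 \<le> M"
  using v_nonneg[of 1 1] v_le_max[of 1 1] n_pos m_pos by simp

lemma gap_nonneg:
  assumes "j \<in> {1..m}" "p \<in> {1..n}"
  shows "0 \<le> gap j p"
proof (cases "p + 1 \<le> n")
  case True
  have "antimono_on {1..n} (\<lambda>i. v (\<sigma> j i) j)"
    using order assms by (simp add: value_order_def)
  then have "v (\<sigma> j (p + 1)) j \<le> v (\<sigma> j p) j"
    using True assms by (auto simp: monotone_on_def)
  then show ?thesis using True by (simp add: gap_def sorted_value_def)
next
  case False
  then show ?thesis using assms v_nonneg[OF \<sigma>_in[OF assms]]
    by (simp add: gap_def sorted_value_def)
qed

text \<open>Telescoping; the last term is \<open>sorted_value\<close> at position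
  \<open>n + 1\<close>, which is zero by convention.\<close>

lemma sum_gap_from:
  assumes "q \<in> {1..n}"
  shows "(\<Sum>p=q..n. gap j p) = v (\<sigma> j q) j"
  using assms sum_natinterval_diff[of "sorted_value n v \<sigma> j" q n]
  by (simp add: gap_def sorted_value_def)

lemma sum_gap_le: "j \<in> {1..m} \<Longrightarrow> (\<Sum>p=1..n. gap j p) \<le> M"
  using sum_gap_from[of 1 j] v_le_max[OF \<sigma>_in, of j 1 j] n_pos by simp

lemma load_diff: "load (\<lambda>i j. a i j - b i j) j p = load a j p - load b j p"
  by (simp add: load_def sum_subtractf)

lemma load_nonneg:
  assumes "\<And>i j. 0 \<le> y i j"
  shows "0 \<le> load y j p"
  using assms by (simp add: load_def sum_nonneg)

lemma abs_load_le:
  assumes "\<And>i j. \<bar>d i j\<bar> \<le> 1" "p \<le> n"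
  shows "\<bar>load d j p\<bar> \<le> real n"
proof -
  have "\<bar>load d j p\<bar> \<le> (\<Sum>k=1..p. \<bar>d (\<sigma> j k) j\<bar>)"
    unfolding load_def by (rule sum_abs)
  also have "\<dots> \<le> (\<Sum>k=1..p. 1)"
    by (intro sum_mono assms)
  finally show ?thesis using assms(2) by simp
qed

text \<open>The gaps of one item telescope to its largest value, so a pointwise bound costs a factor
  \<open>M\<close> per item and no factor \<open>n\<close> for the positions.\<close>

lemma gap_sum_le:
  assumes "\<And>j p. j \<in> {1..m} \<Longrightarrow> p \<in> {1..n} \<Longrightarrow> f j p \<le> c" "0 \<le> c"
  shows "(\<Sum>j=1..m. \<Sum>p=1..n. gap j p * f j p) \<le> real m * M * c"
proof -
  have "(\<Sum>j=1..m. \<Sum>p=1..n. gap j p * f j p) \<le> (\<Sum>j=1..m. \<Sum>p=1..n. gap j p * c)"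
    by (intro sum_mono mult_left_mono assms gap_nonneg)
  also have "\<dots> = (\<Sum>j=1..m. (\<Sum>p=1..n. gap j p) * c)"
    by (simp add: sum_distrib_right)
  also have "\<dots> \<le> (\<Sum>j=1..m. M * c)"
    by (intro sum_mono mult_right_mono sum_gap_le assms)
  finally show ?thesis by (simp add: mult.assoc)
qed

lemma gap_sum_mono:
  assumes "\<And>j p. j \<in> {1..m} \<Longrightarrow> p \<in> {1..n} \<Longrightarrow> f j p \<le> g j p"
  shows "(\<Sum>j=1..m. \<Sum>p=1..n. gap j p * f j p) \<le> (\<Sum>j=1..m. \<Sum>p=1..n. gap j p * g j p)"
  by (intro sum_mono mult_left_mono assms gap_nonneg)

lemma F_le: "F y \<le> real m * M"
  using gap_sum_le[of "\<lambda>j p. 1 - exp (- load y j p)" 1] by (simp add: F_eq)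

lemma F_nonneg:
  assumes "\<And>i j. 0 \<le> y i j"
  shows "0 \<le> F y"
  unfolding F_eq using load_nonneg[OF assms]
  by (intro sum_nonneg mult_nonneg_nonneg gap_nonneg) auto

lemma F_zero: "F (\<lambda>i j. 0) = 0"
  by (simp add: F_eq load_def)

text \<open>\<open>\<sigma> j\<close> maps positions to bins, so loads read only entries in the
  index range. This allows the extracted marginals to be compared with \<open>y\<close> on that
  range alone.\<close>

lemma F_cong:
  assumes "\<And>i j. i \<in> {1..n} \<Longrightarrow> j \<in> {1..m} \<Longrightarrow> a i j = b i j"
  shows "F a = F b"
proof -
  have "load a j p = load b j p" if "j \<in> {1..m}" "p \<in> {1..n}" for j p
    unfolding load_def using that by (intro sum.cong refl assms \<sigma>_in) auto
  then show ?thesis by (simp add: F_eq)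
qed

section \<open>Gradient, concavity and second-order ascent\<close>

text \<open>The indicator sum tells whether bin \<open>i\<close> is among the first \<open>p\<close>
  positions. It is left unevaluated so that \<open>ip_grad\<close> can exchange it with the sum over
  bins.\<close>

lemma grad_eq:
  assumes j: "j \<in> {1..m}"
  shows "grad y i j =
    (\<Sum>p=1..n. gap j p * (exp (- load y j p) * (\<Sum>k=1..p. if \<sigma> j k = i then 1 else 0)))"
proof -
  define Y where "Y t = y(i := (y i)(j := t))" for t
  have load_Y: "load (Y t) j' p = (\<Sum>k=1..p. if \<sigma> j' k = i \<and> j' = j then t else y (\<sigma> j' k) j')"
    for t j' p
    unfolding load_def Y_def by (intro sum.cong) auto
  have Y_id: "Y (y i j) = y" by (simp add: Y_def)
  \<comment> \<open>\<open>P\<close> does not depend on \<open>t\<close>, so each branch is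
    differentiated separately.\<close>
  have *: "((\<lambda>t. if P then t else c) has_real_derivative (if P then 1 else 0)) (at t)" for P c t
    by (auto intro: DERIV_ident DERIV_const)
  have load_deriv: "((\<lambda>t. load (Y t) j' p) has_real_derivative
      (\<Sum>k=1..p. if \<sigma> j' k = i \<and> j' = j then 1 else 0)) (at t)" for t j' p
    unfolding load_Y by (rule DERIV_sum) (rule *)
  have "((\<lambda>t. F (Y t)) has_real_derivative
     (\<Sum>j'=1..m. \<Sum>p=1..n. gap j' p * (exp (- load (Y t) j' p) *
        (\<Sum>k=1..p. if \<sigma> j' k = i \<and> j' = j then 1 else 0)))) (at t)" for t
    unfolding F_eq by (auto intro!: DERIV_sum derivative_eq_intros load_deriv)
  from DERIV_imp_deriv[OF this[of "y i j"]]
  have "grad y i j = (\<Sum>j'=1..m. \<Sum>p=1..n. gap j' p * (exp (- load y j' p) *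
        (\<Sum>k=1..p. if \<sigma> j' k = i \<and> j' = j then 1 else 0)))"
    by (simp add: objective_gradient_def Y_def[symmetric] Y_id)
  also have "\<dots> = (\<Sum>j'=1..m. if j' = j then (\<Sum>p=1..n. gap j p * (exp (- load y j p) *
        (\<Sum>k=1..p. if \<sigma> j k = i then 1 else 0))) else 0)"
    by (intro sum.cong) auto
  finally show ?thesis using j by (simp add: sum.delta)
qed

lemma grad_nonneg: "j \<in> {1..m} \<Longrightarrow> 0 \<le> grad y i j"
  by (auto simp: grad_eq intro!: sum_nonneg mult_nonneg_nonneg gap_nonneg)

text \<open>The chain rule in direction \<open>a\<close>: loads are linear, so
  \<open>1 - exp (- load y j p)\<close> changes at rate
  \<open>exp (- load y j p) * load a j p\<close>. Formally, the sum over bins is moved inside until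
  it meets the indicators.\<close>

lemma ip_grad:
  "ip a (grad y) = (\<Sum>j=1..m. \<Sum>p=1..n. gap j p * (exp (- load y j p) * load a j p))"
proof -
  have "ip a (grad y) = (\<Sum>j=1..m. \<Sum>i=1..n. a i j * grad y i j)"
    unfolding dot_def by (rule sum.swap)
  also have "\<dots> = (\<Sum>j=1..m. \<Sum>p=1..n. gap j p * (exp (- load y j p) * load a j p))"
  proof (rule sum.cong[OF refl])
    fix j assume j: "j \<in> {1..m}"
    have "(\<Sum>i=1..n. a i j * grad y i j) = (\<Sum>i=1..n. \<Sum>p=1..n.
        gap j p * (exp (- load y j p) * (\<Sum>k=1..p. if \<sigma> j k = i then a i j else 0)))"
      by (intro sum.cong refl)
        (simp add: grad_eq[OF j] sum_distrib_left algebra_simps if_distrib cong: if_cong)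
    also have "\<dots> = (\<Sum>p=1..n. gap j p * (exp (- load y j p) *
        (\<Sum>i=1..n. \<Sum>k=1..p. if \<sigma> j k = i then a i j else 0)))"
      by (subst sum.swap) (simp add: sum_distrib_left)
    also have "\<dots> = (\<Sum>p=1..n. gap j p * (exp (- load y j p) * load a j p))"
    proof (intro sum.cong refl)
      fix p assume p: "p \<in> {1..n}"
      have "(\<Sum>i=1..n. \<Sum>k=1..p. if \<sigma> j k = i then a i j else 0)
          = (\<Sum>k=1..p. \<Sum>i=1..n. if \<sigma> j k = i then a i j else 0)"
        by (rule sum.swap)
      also have "\<dots> = load a j p"
        unfolding load_def
      proof (intro sum.cong refl)
        fix k assume "k \<in> {1..p}"
        \<comment> \<open>\<open>\<sigma> j k\<close> is a bin, hence exactly one index of the sum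
          over \<open>i\<close> survives.\<close>
        with p j have "\<sigma> j k \<in> {1..n}" by (intro \<sigma>_in) auto
        then show "(\<Sum>i=1..n. if \<sigma> j k = i then a i j else 0) = a (\<sigma> j k) j"
          by (simp add: sum.delta')
      qed
      finally show "gap j p * (exp (- load y j p) *
          (\<Sum>i=1..n. \<Sum>k=1..p. if \<sigma> j k = i then a i j else 0))
        = gap j p * (exp (- load y j p) * load a j p)"
        by simp
    qed
    finally show "(\<Sum>i=1..n. a i j * grad y i j)
      = (\<Sum>p=1..n. gap j p * (exp (- load y j p) * load a j p))" .
  qed
  finally show ?thesis .
qed

text \<open>Termwise, this is \<open>1 + s \<le> exp s\<close> for
  \<open>s = load a j p - load b j p\<close>, multiplied by
  \<open>exp (- load a j p)\<close>.\<close>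

lemma F_concave: "F b - F a \<le> ip (\<lambda>i j. b i j - a i j) (grad a)"
proof -
  have "F b - F a = (\<Sum>j=1..m. \<Sum>p=1..n. gap j p * (exp (- load a j p) - exp (- load b j p)))"
    unfolding F_eq by (simp add: sum_subtractf[symmetric] algebra_simps)
  also have "\<dots> \<le> ip (\<lambda>i j. b i j - a i j) (grad a)"
    unfolding ip_grad
  proof (rule gap_sum_mono)
    fix j p
    have "exp (- load a j p) * (1 + (load a j p - load b j p))
        \<le> exp (- load a j p) * exp (load a j p - load b j p)"
      by (intro mult_left_mono exp_ge_add_one_self) simp
    then show "exp (- load a j p) - exp (- load b j p)
        \<le> exp (- load a j p) * load (\<lambda>i j. b i j - a i j) j p"
      by (simp add: load_diff exp_add[symmetric] algebra_simps)
  qed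
  finally show ?thesis .
qed

text \<open>With \<open>s = \<delta> * load d j p\<close>, the error of a term is
  \<open>exp (- load y j p) * (exp (- s) - 1 + s)\<close>. It is at most \<open>s\<^sup>2\<close>,
  because the first factor is at most 1 for nonnegative \<open>y\<close> and
  \<open>\<bar>s\<bar> \<le> \<delta> * real n \<le> 1\<close>.\<close>

lemma F_ascent:
  assumes y: "\<And>i j. 0 \<le> y i j" and d: "\<And>i j. \<bar>d i j\<bar> \<le> 1"
    and \<delta>: "0 \<le> \<delta>" "\<delta> * real n \<le> 1"
  shows "F (\<lambda>i j. y i j + \<delta> * d i j) - F y
    \<ge> \<delta> * ip d (grad y) - real m * M * (\<delta> * real n)\<^sup>2"
proof -
  let ?y = "\<lambda>i j. y i j + \<delta> * d i j"
  \<comment> \<open>The left side is the shortfall of the actual increase against the linear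
    prediction.\<close>
  have "\<delta> * ip d (grad y) + (F y - F ?y) = (\<Sum>j=1..m. \<Sum>p=1..n. gap j p *
      (exp (- load ?y j p) - exp (- load y j p) + exp (- load y j p) * (\<delta> * load d j p)))"
    unfolding F_eq ip_grad
    by (simp add: sum_subtractf[symmetric] sum.distrib[symmetric] sum_distrib_left algebra_simps)
  also have "\<dots> \<le> real m * M * (\<delta> * real n)\<^sup>2"
  proof (rule gap_sum_le)
    fix j p assume "j \<in> {1..m}" "p \<in> {1..n}"
    define s where "s = \<delta> * load d j p"
    have "\<bar>s\<bar> \<le> \<delta> * real n"
      using \<delta> abs_load_le[of d p j] d \<open>p \<in> {1..n}\<close>
      by (simp add: s_def abs_mult mult_left_mono)
    then have "\<bar>- s\<bar> \<le> 1" "s\<^sup>2 \<le> (\<delta> * real n)\<^sup>2"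
      using \<delta> by (auto simp: abs_le_square_iff[symmetric])
    have "load ?y j p = load y j p + s"
      by (simp add: load_def s_def sum.distrib sum_distrib_left)
    then have "exp (- load ?y j p) - exp (- load y j p) + exp (- load y j p) * s
       = exp (- load y j p) * (exp (- s) - 1 + s)"
      by (simp add: algebra_simps exp_add[symmetric])
    also have "\<dots> \<le> exp (- load y j p) * s\<^sup>2"
      using exp_le_quadratic[OF \<open>\<bar>- s\<bar> \<le> 1\<close>] by (intro mult_left_mono) auto
    also have "\<dots> \<le> 1 * s\<^sup>2"
      using load_nonneg[OF y] by (intro mult_right_mono) auto
    finally show "exp (- load ?y j p) - exp (- load y j p)
        + exp (- load y j p) * (\<delta> * load d j p) \<le> (\<delta> * real n)\<^sup>2"
      using \<open>s\<^sup>2 \<le> _\<close> by (simp add: s_def)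
  qed simp
  finally show ?thesis by simp
qed

lemma ip_grad_nonneg:
  assumes "\<And>i j. 0 \<le> a i j"
  shows "0 \<le> ip a (grad y)"
  unfolding ip_grad using load_nonneg[OF assms]
  by (intro sum_nonneg mult_nonneg_nonneg gap_nonneg) auto

text \<open>A crude bound, used twice: for the loss from rounding \<open>1 / \<delta>\<close>, and
  to see that the linear values are nonpositive when \<open>M = 0\<close>.\<close>

lemma ip_grad_le:
  assumes "\<And>i j. \<bar>a i j\<bar> \<le> 1" "\<And>i j. 0 \<le> y i j"
  shows "ip a (grad y) \<le> real m * M * real n"
  unfolding ip_grad
proof (rule gap_sum_le)
  fix j p assume "p \<in> {1..n}"
  then have "\<bar>load a j p\<bar> \<le> real n" using abs_load_le[of a p j] assms by simp
  then have "exp (- load y j p) * load a j p \<le> exp (- load y j p) * real n"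
    by (intro mult_left_mono) auto
  also have "\<dots> \<le> 1 * real n"
    using load_nonneg[OF assms(2)] by (intro mult_right_mono) auto
  finally show "exp (- load y j p) * load a j p \<le> real n" by simp
qed simp

text \<open>From the position \<open>q\<close> of bin \<open>i\<close> onwards the load is at least
  1, and the gaps from \<open>q\<close> on telescope to \<open>v i j = M\<close>.\<close>

lemma max_le_twice_F_singleton:
  assumes i: "i \<in> {1..n}" and j: "j \<in> {1..m}" and "v i j = M"
  shows "M \<le> 2 * F (\<lambda>i' j'. if i' = i \<and> j' = j then 1 else 0)"
proof -
  let ?y = "\<lambda>i' j'. if i' = i \<and> j' = j then 1 else 0 :: real"
  from i obtain q where q: "q \<in> {1..n}" "\<sigma> j q = i"
    using permutes_image[OF \<sigma>_permutes[OF j]] by (metis imageE)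
  have load_ge: "1 \<le> load ?y j p" if "p \<in> {q..n}" for p
  proof -
    have "?y (\<sigma> j q) j \<le> (\<Sum>k=1..p. ?y (\<sigma> j k) j)"
      using that q by (intro member_le_sum) auto
    then show ?thesis using q by (simp add: load_def)
  qed
  have "1 / 2 * M = (\<Sum>p=q..n. gap j p * (1 / 2))"
    using sum_gap_from[OF q(1), of j] q(2) assms by (simp add: sum_divide_distrib[symmetric])
  also have "\<dots> \<le> (\<Sum>p=q..n. gap j p * (1 - exp (- load ?y j p)))"
  proof (intro sum_mono mult_left_mono)
    fix p assume p: "p \<in> {q..n}"
    show "0 \<le> gap j p" using p q j by (intro gap_nonneg) auto
    \<comment> \<open>The factor 2 comes from \<open>1 + 1 \<le> exp 1\<close>, which gives
      \<open>1 - exp (- load) \<ge> 1 / 2\<close>.\<close>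
    have "2 \<le> exp (load ?y j p)"
      using load_ge[OF p] exp_ge_add_one_self[of "load ?y j p"] by linarith
    then show "1 / 2 \<le> 1 - exp (- load ?y j p)"
      by (simp add: exp_minus field_simps)
  qed
  also have "\<dots> \<le> (\<Sum>p=1..n. gap j p * (1 - exp (- load ?y j p)))"
    using q j load_nonneg[of ?y] by (intro sum_mono2 mult_nonneg_nonneg gap_nonneg) auto
  also have "\<dots> \<le> F ?y"
    unfolding F_eq using j load_nonneg[of ?y]
    by (intro member_le_sum[where f = "\<lambda>j. \<Sum>p=1..n. gap j p * (1 - exp (- load ?y j p))"]
        sum_nonneg mult_nonneg_nonneg gap_nonneg) auto
  finally show ?thesis by simp
qed

end

section \<open>Step size and the knapsack subroutine as an approximate linear oracle\<close>

locale fractional_search = ordered_values +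
  fixes w :: "nat \<Rightarrow> nat \<Rightarrow> real" and C :: "nat \<Rightarrow> real"
    and knapsack :: "nat \<Rightarrow> (nat \<Rightarrow> real) \<Rightarrow> real \<Rightarrow> nat set" and \<epsilon> :: real
  assumes fptas: "is_knapsack_fptas n m w C knapsack"
    and \<epsilon>_pos: "0 < \<epsilon>" and \<epsilon>_less_1: "\<epsilon> < 1"
begin

abbreviation "feas \<equiv> feasible_sets m w C"
abbreviation "\<delta> \<equiv> step_size n m \<epsilon>"
abbreviation "new_point y \<equiv> search_point n knapsack \<epsilon> (grad y)"

lemma \<delta>_pos: "0 < \<delta>"
  using \<epsilon>_pos n_pos m_pos by (simp add: step_size_def)

lemma \<delta>_mult: "real m * (real n)\<^sup>2 * \<delta> = \<epsilon> / 6"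
  using n_pos m_pos by (simp add: step_size_def)

lemma \<delta>_mult_le: "real m * real n * \<delta> \<le> \<epsilon> / 6"
proof -
  have "real m * (real n * 1) * \<delta> \<le> real m * (real n * real n) * \<delta>"
    using n_pos \<delta>_pos by (intro mult_right_mono mult_left_mono) auto
  then show ?thesis using \<delta>_mult by (simp add: power2_eq_square)
qed

lemma \<delta>_n_le: "\<delta> * real n \<le> 1 / 6"
proof -
  have "1 * (real n * \<delta>) \<le> real m * (real n * \<delta>)"
    using m_pos \<delta>_pos by (intro mult_right_mono) auto
  then show ?thesis using \<delta>_mult_le \<epsilon>_less_1 by (simp add: mult_ac)
qed

lemma \<delta>_le: "\<delta> \<le> 1 / 6"
proof -
  have "\<delta> * 1 \<le> \<delta> * real n"
    using n_pos \<delta>_pos by (intro mult_left_mono) auto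
  then show ?thesis using \<delta>_n_le by simp
qed

text \<open>Summed over the bins, this is the common benchmark: \<open>new_point\<close> reaches a
  \<open>1 - \<epsilon>\<close> fraction of it, and no point of the polytope exceeds it.\<close>

definition best :: "(nat \<Rightarrow> nat \<Rightarrow> real) \<Rightarrow> nat \<Rightarrow> real" where
  "best u i = Max {\<Sum>j\<in>T. u i j | T. T \<in> feas i}"

lemma knapsack_feas:
  assumes "i \<in> {1..n}"
  shows "knapsack i (grad y i) \<epsilon> \<in> feas i"
  using fptas assms grad_nonneg \<epsilon>_pos \<epsilon>_less_1 by (simp add: is_knapsack_fptas_def)

lemma best_le_knapsack:
  assumes "i \<in> {1..n}"
  shows "(1 - \<epsilon>) * best (grad y) i \<le> (\<Sum>j\<in>knapsack i (grad y i) \<epsilon>. grad y i j)"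
  using fptas assms grad_nonneg \<epsilon>_pos \<epsilon>_less_1 by (simp add: is_knapsack_fptas_def best_def)

lemma sum_le_best:
  assumes "S \<in> feas i"
  shows "(\<Sum>j\<in>S. u i j) \<le> best u i"
proof -
  have "{\<Sum>j\<in>T. u i j | T. T \<in> feas i} = (\<lambda>T. \<Sum>j\<in>T. u i j) ` feas i"
    by auto
  then show ?thesis unfolding best_def using assms by (intro Max_ge) auto
qed

text \<open>The empty set is infeasible when \<open>C i < 0\<close>, so the witness is the output of
  the subroutine, which its specification makes feasible.\<close>

lemma best_nonneg:
  assumes "i \<in> {1..n}"
  shows "0 \<le> best (grad y) i"
proof -
  have "0 \<le> (\<Sum>j\<in>knapsack i (grad y i) \<epsilon>. grad y i j)"
    using knapsack_feas[OF assms, of y]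
    by (intro sum_nonneg grad_nonneg) (auto simp: feasible_sets_def)
  also have "\<dots> \<le> best (grad y) i" by (rule sum_le_best) (rule knapsack_feas[OF assms])
  finally show ?thesis .
qed

text \<open>One feasible set per bin, where bins may share items. Entries are 0 or 1 at all indices,
  since lemmas such as \<open>load_nonneg\<close> quantify over all of them.\<close>

definition choice :: "(nat \<Rightarrow> nat \<Rightarrow> real) \<Rightarrow> bool" where
  "choice z \<longleftrightarrow> (\<forall>i j. z i j \<in> {0, 1}) \<and> (\<forall>i\<in>{1..n}. {j \<in> {1..m}. z i j = 1} \<in> feas i)"

lemma choice_bounds:
  assumes "choice z"
  shows choice_nonneg: "0 \<le> z i j" and choice_le_1: "z i j \<le> 1"
proof -
  have "z i j \<in> {0, 1}" using assms unfolding choice_def by blast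
  then show "0 \<le> z i j" "z i j \<le> 1" by auto
qed

lemma choice_new_point: "choice (new_point y)"
proof -
  have "{j \<in> {1..m}. new_point y i j = 1} = knapsack i (grad y i) \<epsilon>" if "i \<in> {1..n}" for i
    using knapsack_feas[OF that, of y] that by (auto simp: search_point_def feasible_sets_def)
  then show ?thesis using knapsack_feas by (simp add: choice_def search_point_def)
qed

lemma ip_new_point: "ip (new_point y) (grad y) \<ge> (1 - \<epsilon>) * (\<Sum>i=1..n. best (grad y) i)"
proof -
  have "(\<Sum>j=1..m. new_point y i j * grad y i j) = (\<Sum>j\<in>knapsack i (grad y i) \<epsilon>. grad y i j)"
    if "i \<in> {1..n}" for i
  proof -
    have "knapsack i (grad y i) \<epsilon> \<subseteq> {1..m}"
      using knapsack_feas[OF that] by (simp add: feasible_sets_def)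
    then show ?thesis using that
      by (intro sum.mono_neutral_cong_right) (auto simp: search_point_def)
  qed
  then show ?thesis
    unfolding dot_def sum_distrib_left by (intro sum_mono) (simp add: best_le_knapsack)
qed

text \<open>Exchanging sums turns the contribution of a bin into a combination of set profits with
  weights \<open>x i S\<close>. The weights may sum to less than 1, which is why
  \<open>best_nonneg\<close> enters.\<close>

lemma ip_marginals_le:
  assumes x: "x \<in> config_polytope n m w C"
  shows "ip (marginals m w C x) (grad y) \<le> (\<Sum>i=1..n. best (grad y) i)"
  unfolding dot_def
proof (intro sum_mono)
  fix i assume i: "i \<in> {1..n}"
  have "(\<Sum>j=1..m. marginals m w C x i j * grad y i j)
      = (\<Sum>j=1..m. \<Sum>S\<in>feas i. if j \<in> S then x i S * grad y i j else 0)"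
    unfolding marginals_def sum_distrib_right sum.inter_filter[OF finite_feasible_sets]
    by (intro sum.cong refl) simp
  also have "\<dots> = (\<Sum>S\<in>feas i. \<Sum>j=1..m. if j \<in> S then x i S * grad y i j else 0)"
    by (rule sum.swap)
  also have "\<dots> = (\<Sum>S\<in>feas i. x i S * (\<Sum>j\<in>S. grad y i j))"
  proof (intro sum.cong refl)
    fix S assume "S \<in> feas i"
    then have "S \<subseteq> {1..m}" by (simp add: feasible_sets_def)
    then show "(\<Sum>j=1..m. if j \<in> S then x i S * grad y i j else 0) = x i S * (\<Sum>j\<in>S. grad y i j)"
      unfolding sum_distrib_left by (intro sum.mono_neutral_cong_right) auto
  qed
  also have "\<dots> \<le> (\<Sum>S\<in>feas i. x i S * best (grad y) i)"
    using x i by (intro sum_mono mult_left_mono sum_le_best) (auto simp: config_polytope_def)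
  also have "\<dots> = (\<Sum>S\<in>feas i. x i S) * best (grad y) i"
    by (simp add: sum_distrib_right)
  also have "\<dots> \<le> 1 * best (grad y) i"
    using x i best_nonneg[OF i] by (intro mult_right_mono) (auto simp: config_polytope_def)
  finally show "(\<Sum>j=1..m. marginals m w C x i j * grad y i j) \<le> best (grad y) i" by simp
qed

section \<open>Loop invariant and progress per round\<close>

text \<open>The loop invariant. The size bound keeps \<open>\<delta> * size Z \<le> 1\<close>, which
  later puts the extracted configurations into the polytope.\<close>

definition valid :: "(nat \<Rightarrow> nat \<Rightarrow> real) \<times> (nat \<Rightarrow> nat \<Rightarrow> real) multiset \<Rightarrow> bool" where
  "valid = (\<lambda>(y, Z). (\<forall>z\<in>#Z. choice z) \<and> y = (\<lambda>i j. \<delta> * (\<Sum>z\<in>#Z. z i j)) \<and>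
     int (size Z) \<le> \<lfloor>1 / \<delta>\<rfloor>)"

lemma valid_nonneg:
  assumes "valid (y, Z)"
  shows "0 \<le> y i j"
proof -
  have "0 \<le> (\<Sum>z\<in>#Z. z i j)"
    using assms size_mult_le_sum_mset[of Z 0 "\<lambda>z. z i j"] choice_nonneg by (simp add: valid_def)
  then show ?thesis using assms \<delta>_pos by (simp add: valid_def)
qed

text \<open>Rounding \<open>1 / \<delta>\<close> down costs at most \<open>\<delta> m n M \<le> \<epsilon> M / 6\<close> compared with the average over \<open>Z\<close>.\<close>

lemma ip_worst_le:
  assumes "valid (y, Z)" "\<lfloor>1 / \<delta>\<rfloor> \<le> int (size Z)" "zmin \<in># Z"
    and least: "\<And>z. z \<in># Z \<Longrightarrow> ip zmin (grad y) \<le> ip z (grad y)"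
  shows "ip zmin (grad y) \<le> ip y (grad y) + \<epsilon> * M / 6"
proof -
  let ?a = "ip zmin (grad y)"
  have zmin: "choice zmin" using assms by (simp add: valid_def)
  then have a_nonneg: "0 \<le> ?a" by (intro ip_grad_nonneg choice_nonneg)
  have "y = (\<lambda>i j. \<delta> * (\<Sum>z\<in>#Z. z i j))" using assms(1) by (simp add: valid_def)
  then have "ip y (grad y) = \<delta> * (\<Sum>z\<in>#Z. ip z (grad y))"
    by (metis dot_scale_left dot_sum_mset_left)
  moreover have "real (size Z) * ?a \<le> (\<Sum>z\<in>#Z. ip z (grad y))"
    by (intro size_mult_le_sum_mset least)
  ultimately have *: "\<delta> * (real (size Z) * ?a) \<le> ip y (grad y)"
    using \<delta>_pos by (simp add: mult_left_mono)
  \<comment> \<open>\<open>1 / \<delta>\<close> is below its floor plus one, so the total weight of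
    \<open>Z\<close> falls short of 1 by at most \<open>\<delta>\<close>.\<close>
  have "1 / \<delta> \<le> real (size Z) + 1"
    using assms(2) by linarith
  then have "1 \<le> \<delta> * real (size Z) + \<delta>"
    using \<delta>_pos by (simp add: field_simps)
  then have "1 * ?a \<le> (\<delta> * real (size Z) + \<delta>) * ?a"
    using a_nonneg by (intro mult_right_mono)
  moreover have "\<delta> * ?a \<le> \<delta> * (real m * M * real n)"
    using \<delta>_pos zmin valid_nonneg[OF assms(1)] choice_nonneg choice_le_1
    by (intro mult_left_mono ip_grad_le) (auto simp: abs_le_iff intro: order_trans[of _ 0])
  moreover have "\<delta> * (real m * M * real n) \<le> \<epsilon> * M / 6"
    using mult_right_mono[OF \<delta>_mult_le max_nonneg] by (simp add: algebra_simps)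
  ultimately show ?thesis using * by (simp add: algebra_simps)
qed

text \<open>Covers both kinds of update. The 5/6 leaves room for the rounding loss of
  \<open>ip_worst_le\<close>; the second-order error takes another 1/6, and the remaining 4/6 is at
  least 1/2.\<close>

lemma F_gain:
  assumes "\<And>i j. 0 \<le> y i j" "\<And>i j. \<bar>d i j\<bar> \<le> 1" "5 / 6 * (\<epsilon> * M) \<le> ip d (grad y)"
  shows "F y + \<delta> * \<epsilon> * M / 2 \<le> F (\<lambda>i j. y i j + \<delta> * d i j)"
proof -
  have "\<delta> * (5 / 6 * (\<epsilon> * M)) \<le> \<delta> * ip d (grad y)"
    using assms(3) \<delta>_pos by (intro mult_left_mono) auto
  moreover have "real m * M * (\<delta> * real n)\<^sup>2 = \<delta> * (\<epsilon> * M) / 6"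
  proof -
    have "real m * M * (\<delta> * real n)\<^sup>2 = M * \<delta> * (real m * (real n)\<^sup>2 * \<delta>)"
      by (simp add: power2_eq_square algebra_simps)
    then show ?thesis by (simp add: \<delta>_mult)
  qed
  moreover have "0 \<le> \<delta> * (\<epsilon> * M)"
    using \<delta>_pos \<epsilon>_pos max_nonneg by simp
  moreover have "\<delta> * ip d (grad y) - real m * M * (\<delta> * real n)\<^sup>2
      \<le> F (\<lambda>i j. y i j + \<delta> * d i j) - F y"
    using assms(1,2) \<delta>_pos \<delta>_n_le by (intro F_ascent) auto
  moreover have "\<delta> * \<epsilon> * M / 2 = \<delta> * (\<epsilon> * M) / 2" by simp
  ultimately show ?thesis by linarith
qed

lemma step_valid_gain:
  assumes valid: "valid s" and cont: "search_continues n m v \<sigma> knapsack \<epsilon> s"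
  defines "s' \<equiv> search_step n m v \<sigma> knapsack \<epsilon> s"
  shows "valid s'" "F (fst s) + \<delta> * \<epsilon> * M / 2 \<le> F (fst s')"
proof -
  obtain y Z where s: "s = (y, Z)" by (cases s)
  let ?u = "grad y"
  let ?z = "new_point y"
  have y0: "0 \<le> y i j" for i j using valid_nonneg valid s by blast
  have z: "choice ?z" by (rule choice_new_point)
  have y: "y = (\<lambda>i j. \<delta> * (\<Sum>z\<in>#Z. z i j))" and Z: "\<And>z. z \<in># Z \<Longrightarrow> choice z"
    and size: "int (size Z) \<le> \<lfloor>1 / \<delta>\<rfloor>"
    using valid by (simp_all add: s valid_def)
  have progress: "ip ?z ?u - ip y ?u > \<epsilon> * M"
    using cont by (simp add: s search_continues_def Let_def dot_diff_left)
  have \<epsilon>M: "0 \<le> \<epsilon> * M" using \<epsilon>_pos max_nonneg by simp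
  have "valid s' \<and> F (fst s) + \<delta> * \<epsilon> * M / 2 \<le> F (fst s')"
  proof (cases "int (size Z) < \<lfloor>1 / \<delta>\<rfloor>")
    case True
    then have s': "s' = (\<lambda>i j. y i j + \<delta> * ?z i j, add_mset ?z Z)"
      by (simp add: s'_def s search_step_def Let_def)
    have "valid s'"
      using True Z z by (auto simp: s' valid_def y algebra_simps)
    moreover have "F y + \<delta> * \<epsilon> * M / 2 \<le> F (\<lambda>i j. y i j + \<delta> * ?z i j)"
    proof (rule F_gain[OF y0])
      show "\<bar>?z i j\<bar> \<le> 1" for i j using choice_nonneg[OF z] choice_le_1[OF z] by simp
      \<comment> \<open>Nothing is removed in this branch, so dropping \<open>ip y ?u\<close> from
        the stopping test is enough.\<close>
      have "0 \<le> ip y ?u" by (intro ip_grad_nonneg y0)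
      then show "5 / 6 * (\<epsilon> * M) \<le> ip ?z ?u"
        using progress \<epsilon>M by linarith
    qed
    ultimately show ?thesis by (simp add: s s')
  next
    case False
    define zmin where "zmin = arg_min_on (\<lambda>z'. ip z' ?u) (set_mset Z)"
    have s': "s' = (\<lambda>i j. y i j + \<delta> * (?z i j - zmin i j), add_mset ?z (Z - {#zmin#}))"
      using False by (simp add: s'_def s search_step_def Let_def zmin_def)
    \<comment> \<open>There are at least six slots, so a full \<open>Z\<close> is nonempty and the
      minimiser exists.\<close>
    have "6 \<le> 1 / \<delta>" using \<delta>_pos \<delta>_le by (simp add: field_simps)
    then have "Z \<noteq> {#}" using False by (auto simp: le_floor_iff)
    then have zmin: "zmin \<in># Z" and least: "\<And>z. z \<in># Z \<Longrightarrow> ip zmin ?u \<le> ip z ?u"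
      using arg_min_if_finite[of "set_mset Z" "\<lambda>z'. ip z' ?u"]
      by (auto simp: zmin_def[symmetric] not_less)
    \<comment> \<open>Splitting off \<open>zmin\<close> makes the exchange visible in the sum that
      defines \<open>y\<close>.\<close>
    obtain Z' where Z': "Z = add_mset zmin Z'" using zmin by (metis insert_DiffM)
    have "valid s'"
      using Z z size by (auto simp: s' valid_def y Z' algebra_simps)
    moreover have "F y + \<delta> * \<epsilon> * M / 2 \<le> F (\<lambda>i j. y i j + \<delta> * (?z i j - zmin i j))"
    proof (rule F_gain[OF y0])
      show "\<bar>?z i j - zmin i j\<bar> \<le> 1" for i j
        using choice_nonneg[OF z, of i j] choice_le_1[OF z, of i j]
          choice_nonneg[OF Z[OF zmin], of i j] choice_le_1[OF Z[OF zmin], of i j] by linarith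
      have "ip zmin ?u \<le> ip y ?u + \<epsilon> * M / 6"
        using valid False by (intro ip_worst_le[OF _ _ zmin least]) (auto simp: s)
      then show "5 / 6 * (\<epsilon> * M) \<le> ip (\<lambda>i j. ?z i j - zmin i j) ?u"
        using progress by (simp add: dot_diff_left)
    qed
    ultimately show ?thesis by (simp add: s s')
  qed
  then show "valid s'" "F (fst s) + \<delta> * \<epsilon> * M / 2 \<le> F (fst s')" by auto
qed

section \<open>Termination\<close>

text \<open>The guaranteed gain is proportional to \<open>M\<close> and would vanish for
  \<open>M = 0\<close>; in that case the strict test already fails.\<close>

lemma continues_imp_max_pos:
  assumes "valid (y, Z)" "search_continues n m v \<sigma> knapsack \<epsilon> (y, Z)"
  shows "0 < M"
proof (rule ccontr)
  assume "\<not> 0 < M"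
  then have M: "M = 0" using max_nonneg by simp
  note y0 = valid_nonneg[OF assms(1)]
  have z: "choice (new_point y)" by (rule choice_new_point)
  have "ip (new_point y) (grad y) \<le> real m * M * real n"
    using choice_nonneg[OF z] choice_le_1[OF z] by (intro ip_grad_le y0) simp
  moreover have "0 \<le> ip y (grad y)" by (intro ip_grad_nonneg y0)
  ultimately show False
    using assms(2) M by (simp add: search_continues_def Let_def dot_diff_left)
qed

lemma search_terminates:
  obtains y Z where
    "while_option (search_continues n m v \<sigma> knapsack \<epsilon>) (search_step n m v \<sigma> knapsack \<epsilon>)
       (\<lambda>i j. 0, {#}) = Some (y, Z)"
    "valid (y, Z)" "\<not> search_continues n m v \<sigma> knapsack \<epsilon> (y, Z)"
proof -
  let ?b = "search_continues n m v \<sigma> knapsack \<epsilon>" and ?c = "search_step n m v \<sigma> knapsack \<epsilon>"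
  define g where "g = \<delta> * \<epsilon> * M / 2"
  \<comment> \<open>Counts how many gains of size \<open>g\<close> still fit below the upper bound
    \<open>real m * M\<close> on \<open>F\<close>.\<close>
  define f where "f s = nat \<lfloor>(real m * M - F (fst s)) / g\<rfloor>"
    for s :: "(nat \<Rightarrow> nat \<Rightarrow> real) \<times> (nat \<Rightarrow> nat \<Rightarrow> real) multiset"
  have init: "valid (\<lambda>i j. 0, {#})"
    using \<delta>_pos by (simp add: valid_def)
  have "\<exists>t. while_option ?b ?c (\<lambda>i j. 0, {#}) = Some t"
  proof (rule measure_while_option_Some[where P = valid and f = f])
    fix s assume s: "valid s" "?b s"
    have "0 < M" using continues_imp_max_pos s by (cases s) blast
    then have g: "0 < g" using \<delta>_pos \<epsilon>_pos by (simp add: g_def)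
    have gain: "F (fst s) + g \<le> F (fst (?c s))"
      using step_valid_gain(2)[OF s] by (simp add: g_def)
    have "(real m * M - F (fst (?c s))) / g \<le> (real m * M - F (fst s) - g) / g"
      using g gain by (intro divide_right_mono) auto
    also have "\<dots> = (real m * M - F (fst s)) / g - 1"
      using g by (simp add: diff_divide_distrib)
    finally have 1: "(real m * M - F (fst (?c s))) / g \<le> (real m * M - F (fst s)) / g - 1" .
    \<comment> \<open>Nonnegativity of the new quotient prevents \<open>nat\<close> from truncating
      both measures to 0.\<close>
    have "0 \<le> (real m * M - F (fst (?c s))) / g"
      using g F_le[of "fst (?c s)"] by simp
    with 1 have "f (?c s) < f s"
      unfolding f_def by linarith
    then show "valid (?c s) \<and> f (?c s) < f s"
      using step_valid_gain(1)[OF s] by simp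
  qed (rule init)
  then obtain y Z where yZ: "while_option ?b ?c (\<lambda>i j. 0, {#}) = Some (y, Z)" by auto
  moreover have "valid (y, Z)"
    by (rule while_option_rule[where P = valid, OF step_valid_gain(1) yZ init])
  moreover have "\<not> ?b (y, Z)"
    using while_option_stop[OF yZ] .
  ultimately show thesis by (rule that)
qed

section \<open>From the multiset of points back to configurations\<close>

lemma extract_configs_eq:
  assumes "i \<in> {1..n}"
  shows "extract_configs n m \<delta> Z i S = (\<Sum>z\<in>#Z. if S = {j \<in> {1..m}. z i j = 1} then \<delta> else 0)"
  using assms by (simp add: extract_configs_def)

text \<open>In bin \<open>i\<close> each point puts weight \<open>\<delta>\<close> on exactly one
  set, and that set is feasible. A trivial \<open>P\<close> yields the total weight of the bin, and
  membership of \<open>j\<close> yields the marginals.\<close>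

lemma sum_extract_configs:
  assumes i: "i \<in> {1..n}" and Z: "\<And>z. z \<in># Z \<Longrightarrow> choice z"
  shows "(\<Sum>S | S \<in> feas i \<and> P S. extract_configs n m \<delta> Z i S)
    = (\<Sum>z\<in>#Z. if P {j \<in> {1..m}. z i j = 1} then \<delta> else 0)"
proof -
  have "(\<Sum>S | S \<in> feas i \<and> P S. extract_configs n m \<delta> Z i S)
      = (\<Sum>z\<in>#Z. \<Sum>S | S \<in> feas i \<and> P S. if S = {j \<in> {1..m}. z i j = 1} then \<delta> else 0)"
    unfolding extract_configs_eq[OF i] by (rule sum_sum_mset_swap)
  also have "\<dots> = (\<Sum>z\<in>#Z. if P {j \<in> {1..m}. z i j = 1} then \<delta> else 0)"
  proof (intro arg_cong[of _ _ sum_mset] image_mset_cong)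
    fix z assume "z \<in># Z"
    then have "{j \<in> {1..m}. z i j = 1} \<in> feas i" using Z i by (simp add: choice_def)
    then show "(\<Sum>S | S \<in> feas i \<and> P S. if S = {j \<in> {1..m}. z i j = 1} then \<delta> else 0)
       = (if P {j \<in> {1..m}. z i j = 1} then \<delta> else 0)"
      by (subst sum.delta) auto
  qed
  finally show ?thesis .
qed

lemma extract_configs_in_polytope:
  assumes "valid (y, Z)"
  shows "extract_configs n m \<delta> Z \<in> config_polytope n m w C"
proof -
  let ?x = "extract_configs n m \<delta> Z"
  have Z: "\<And>z. z \<in># Z \<Longrightarrow> choice z" using assms by (simp add: valid_def)
  have "real (size Z) \<le> 1 / \<delta>" using assms by (simp add: valid_def le_floor_iff)
  then have total: "real (size Z) * \<delta> \<le> 1" using \<delta>_pos by (simp add: field_simps)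
  have "0 \<le> ?x i S" for i S
    using size_mult_le_sum_mset[of Z 0] \<delta>_pos by (simp add: extract_configs_def)
  moreover have "?x i S \<le> 1" for i S
  proof -
    have "?x i S \<le> (\<Sum>z\<in>#Z. \<delta>)"
      unfolding extract_configs_def using \<delta>_pos by (intro sum_mset_mono) auto
    then show ?thesis using total by simp
  qed
  moreover have "(\<Sum>S\<in>feas i. ?x i S) \<le> 1" if "i \<in> {1..n}" for i
    using sum_extract_configs[OF that Z, where P = "\<lambda>_. True"] total by simp
  ultimately show ?thesis by (simp add: config_polytope_def)
qed

lemma F_marginals_extract_configs:
  assumes "valid (y, Z)"
  shows "F (marginals m w C (extract_configs n m \<delta> Z)) = F y"
proof (rule F_cong)
  fix i j assume i: "i \<in> {1..n}" and j: "j \<in> {1..m}"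
  have Z: "\<And>z. z \<in># Z \<Longrightarrow> choice z" using assms by (simp add: valid_def)
  have "marginals m w C (extract_configs n m \<delta> Z) i j
      = (\<Sum>z\<in>#Z. if j \<in> {j \<in> {1..m}. z i j = 1} then \<delta> else 0)"
    unfolding marginals_def using sum_extract_configs[OF i Z, where P = "\<lambda>S. j \<in> S"] .
  also have "\<dots> = (\<Sum>z\<in>#Z. \<delta> * z i j)"
  proof (intro arg_cong[of _ _ sum_mset] image_mset_cong)
    fix z assume "z \<in># Z"
    then have "z i j \<in> {0, 1}" using Z by (simp add: choice_def)
    then show "(if j \<in> {j \<in> {1..m}. z i j = 1} then \<delta> else 0) = \<delta> * z i j"
      using j by auto
  qed
  also have "\<dots> = y i j"
    using assms by (simp add: valid_def sum_mset_distrib_left)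
  finally show "marginals m w C (extract_configs n m \<delta> Z) i j = y i j" .
qed

section \<open>Local optimality and the approximation ratio\<close>

text \<open>
  The additive error of local optimality is \<open>\<epsilon>\<close> times the optimal linear value, which
  concavity at the origin bounds in terms of \<open>F y\<close> itself, without a factor \<open>n\<close>.
\<close>

lemma local_optimum:
  assumes valid: "valid (y, Z)" and stop: "\<not> search_continues n m v \<sigma> knapsack \<epsilon> (y, Z)"
    and x: "x \<in> config_polytope n m w C"
  shows "(1 - \<epsilon>) * F (marginals m w C x) - \<epsilon> * M \<le> F y"
proof -
  let ?u = "grad y" and ?t = "marginals m w C x"
  have "ip (new_point y) ?u - ip y ?u \<le> \<epsilon> * M"
    using stop by (simp add: search_continues_def Let_def dot_diff_left)
  moreover have "(1 - \<epsilon>) * ip ?t ?u \<le> (1 - \<epsilon>) * (\<Sum>i=1..n. best ?u i)"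
    using ip_marginals_le[OF x] \<epsilon>_less_1 by (intro mult_left_mono) auto
  ultimately have 1: "(1 - \<epsilon>) * ip ?t ?u \<le> ip y ?u + \<epsilon> * M"
    using ip_new_point[of y] by linarith
  have "F ?t - F y \<le> ip ?t ?u - ip y ?u"
    using F_concave[of ?t y] by (simp add: dot_diff_left)
  then have "(1 - \<epsilon>) * (F ?t - F y) \<le> (1 - \<epsilon>) * (ip ?t ?u - ip y ?u)"
    using \<epsilon>_less_1 by (intro mult_left_mono) auto
  \<comment> \<open>The terms in \<open>ip y ?u\<close> combine to the coefficient
    \<open>1 - (1 - \<epsilon>) = \<epsilon>\<close>.\<close>
  then have "(1 - \<epsilon>) * F ?t \<le> (1 - \<epsilon>) * F y + \<epsilon> * ip y ?u + \<epsilon> * M"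
    using 1 by (simp add: algebra_simps)
  moreover have "ip y ?u \<le> F y"
    using F_concave[of "\<lambda>i j. 0" y] by (simp add: F_zero dot_diff_left) (simp add: dot_def sum_negf)
  then have "\<epsilon> * ip y ?u \<le> \<epsilon> * F y"
    using \<epsilon>_pos by (intro mult_left_mono) auto
  ultimately show ?thesis by (simp add: algebra_simps)
qed

text \<open>The witness \<open>x\<close> puts weight 1 on the configuration \<open>{j}\<close> of
  bin \<open>i\<close> and nothing elsewhere.\<close>

lemma singleton_in_marginal_polytope:
  assumes i: "i \<in> {1..n}" and j: "{j} \<in> feas i"
  shows "(\<lambda>i' j'. if i' = i \<and> j' = j then 1 else 0) \<in> marginal_polytope n m w C"
proof -
  define x where "x i' S = (if i' = i \<and> S = {j} then 1 else 0 :: real)" for i' S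
  have sum_x: "(\<Sum>S | S \<in> feas i' \<and> P S. x i' S) = (if i' = i \<and> P {j} then 1 else 0)" for i' P
  proof (cases "i' = i")
    case True
    then have "(\<Sum>S | S \<in> feas i' \<and> P S. x i' S)
        = (\<Sum>S | S \<in> feas i \<and> P S. if S = {j} then 1 else 0)"
      by (simp add: x_def)
    then show ?thesis using True j by (simp add: sum.delta)
  qed (simp add: x_def)
  have "x \<in> config_polytope n m w C"
    using sum_x[where P = "\<lambda>_. True"] by (auto simp: config_polytope_def) (auto simp: x_def)
  moreover have "marginals m w C x = (\<lambda>i' j'. if i' = i \<and> j' = j then 1 else 0)"
    by (auto simp: marginals_def sum_x fun_eq_iff)
  ultimately show ?thesis
    unfolding marginal_polytope_def by (intro CollectI conjI bexI[of _ x]) auto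
qed

lemma search_approximates:
  assumes "i \<in> {1..n}" "j \<in> {1..m}" "v i j = M" "{j} \<in> feas i"
  shows "\<exists>x. fractional_local_search n m v \<sigma> knapsack \<epsilon> = Some x \<and>
    x \<in> config_polytope n m w C \<and>
    F (marginals m w C x) \<ge> (1 - 3 * \<epsilon>) * (SUP y\<in>marginal_polytope n m w C. F y)"
proof -
  let ?P = "marginal_polytope n m w C"
  define opt where "opt = (SUP y\<in>?P. F y)"
  obtain y Z where run: "while_option (search_continues n m v \<sigma> knapsack \<epsilon>)
      (search_step n m v \<sigma> knapsack \<epsilon>) (\<lambda>i j. 0, {#}) = Some (y, Z)"
    and valid: "valid (y, Z)" and stop: "\<not> search_continues n m v \<sigma> knapsack \<epsilon> (y, Z)"
    by (rule search_terminates)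
  let ?e = "\<lambda>i' j'. if i' = i \<and> j' = j then 1 else 0 :: real"
  have e: "?e \<in> ?P" using assms by (intro singleton_in_marginal_polytope)
  \<comment> \<open>A supremum of reals bounds its members only when the set is bounded
    above.\<close>
  have "bdd_above (F ` ?P)" by (auto intro!: bdd_aboveI[of _ "real m * M"] F_le)
  then have "F ?e \<le> opt" unfolding opt_def using e by (rule cSUP_upper2) simp
  then have M: "M \<le> 2 * opt" using max_le_twice_F_singleton[OF assms(1-3)] by simp
  \<comment> \<open>Division by \<open>1 - \<epsilon> > 0\<close> isolates \<open>F t\<close>, so
    the bound for each point passes to the supremum.\<close>
  have "opt \<le> (F y + \<epsilon> * M) / (1 - \<epsilon>)"
    unfolding opt_def
  proof (rule cSUP_least)
    show "?P \<noteq> {}" using e by auto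
    fix t assume "t \<in> ?P"
    then obtain x where "x \<in> config_polytope n m w C" "t = marginals m w C x"
      by (auto simp: marginal_polytope_def)
    then have "(1 - \<epsilon>) * F t \<le> F y + \<epsilon> * M"
      using local_optimum[OF valid stop, of x] by simp
    then show "F t \<le> (F y + \<epsilon> * M) / (1 - \<epsilon>)"
      using \<epsilon>_less_1 by (simp add: pos_le_divide_eq mult.commute)
  qed
  then have "opt * (1 - \<epsilon>) \<le> F y + \<epsilon> * M"
    using \<epsilon>_less_1 by (simp add: pos_le_divide_eq)
  moreover have "\<epsilon> * M \<le> \<epsilon> * (2 * opt)"
    using M \<epsilon>_pos by (intro mult_left_mono) auto
  ultimately have "(1 - 3 * \<epsilon>) * opt \<le> F y" by (simp add: algebra_simps)
  then show ?thesis
    using run extract_configs_in_polytope[OF valid] F_marginals_extract_configs[OF valid]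
    by (auto simp: fractional_local_search_def opt_def)
qed

text \<open>Needed for replacing \<open>\<epsilon>\<close> by its upper bound
  \<open>1 / real n\<close> in the factor in front of the optimum.\<close>

lemma opt_nonneg:
  assumes "i \<in> {1..n}" "j \<in> {1..m}" "{j} \<in> feas i"
  shows "0 \<le> (SUP y\<in>marginal_polytope n m w C. F y)"
proof (rule cSUP_upper2)
  show "bdd_above (F ` marginal_polytope n m w C)"
    by (auto intro!: bdd_aboveI[of _ "real m * M"] F_le)
  show "(\<lambda>i' j'. if i' = i \<and> j' = j then 1 else 0) \<in> marginal_polytope n m w C"
    using assms by (intro singleton_in_marginal_polytope)
qed (auto intro!: F_nonneg)

end

text \<open>One \<open>\<eta>\<close> serves all instances, so the error is uniform in
  \<open>m\<close>, the values and the weights. The hypothesis that an item of value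
  \<open>M\<close> fits alone in its bin is what makes the additive error
  \<open>\<epsilon> * M\<close> comparable with the optimum.\<close>

theorem lemma3p7:
  "\<exists>\<eta> :: nat \<Rightarrow> real. \<eta> \<in> o(\<lambda>_. 1) \<and>
     (\<forall>(n :: nat) (m :: nat) (v :: nat \<Rightarrow> nat \<Rightarrow> real) (w :: nat \<Rightarrow> nat \<Rightarrow> real) (C :: nat \<Rightarrow> real)
        (\<sigma> :: nat \<Rightarrow> nat \<Rightarrow> nat) (knapsack :: nat \<Rightarrow> (nat \<Rightarrow> real) \<Rightarrow> real \<Rightarrow> nat set) (\<epsilon> :: real).
        1 \<le> n \<and> 1 \<le> m \<and>
        (\<forall>i\<in>{1..n}. \<forall>j\<in>{1..m}. 0 \<le> v i j) \<and>
        (\<exists>i\<in>{1..n}. \<exists>j\<in>{1..m}. v i j = max_value n m v \<and> {j} \<in> feasible_sets m w C i) \<and>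
        value_order n m v \<sigma> \<and>
        is_knapsack_fptas n m w C knapsack \<and>
        0 < \<epsilon> \<and> \<epsilon> < 1 \<and> \<epsilon> \<le> 1 / real n \<longrightarrow>
        (\<exists>x. fractional_local_search n m v \<sigma> knapsack \<epsilon> = Some x \<and>
             x \<in> config_polytope n m w C \<and>
             objective n m v \<sigma> (marginals m w C x)
               \<ge> (1 - \<eta> n) * (SUP y\<in>marginal_polytope n m w C. objective n m v \<sigma> y)))"
proof (intro exI[of _ "\<lambda>n. 3 / real n"] conjI allI impI)
  show "(\<lambda>n. 3 / real n) \<in> o(\<lambda>_. 1)"
    by (rule smalloI_tendsto) (auto intro!: tendsto_eq_intros lim_const_over_n)
next
  fix n m :: nat and v w :: "nat \<Rightarrow> nat \<Rightarrow> real" and C :: "nat \<Rightarrow> real"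
    and \<sigma> :: "nat \<Rightarrow> nat \<Rightarrow> nat" and knapsack :: "nat \<Rightarrow> (nat \<Rightarrow> real) \<Rightarrow> real \<Rightarrow> nat set"
    and \<epsilon> :: real
  assume asm: "1 \<le> n \<and> 1 \<le> m \<and>
        (\<forall>i\<in>{1..n}. \<forall>j\<in>{1..m}. 0 \<le> v i j) \<and>
        (\<exists>i\<in>{1..n}. \<exists>j\<in>{1..m}. v i j = max_value n m v \<and> {j} \<in> feasible_sets m w C i) \<and>
        value_order n m v \<sigma> \<and>
        is_knapsack_fptas n m w C knapsack \<and>
        0 < \<epsilon> \<and> \<epsilon> < 1 \<and> \<epsilon> \<le> 1 / real n"
  then interpret fractional_search n m v \<sigma> w C knapsack \<epsilon>
    by unfold_locales auto
  obtain i j where ij: "i \<in> {1..n}" "j \<in> {1..m}" "v i j = M" "{j} \<in> feas i"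
    using asm by blast
  \<comment> \<open>\<open>\<epsilon> \<le> 1 / real n\<close> orders the two factors, and a
    nonnegative optimum preserves that order even when the left factor is negative.\<close>
  have "(1 - 3 / real n) * (SUP y\<in>marginal_polytope n m w C. F y)
      \<le> (1 - 3 * \<epsilon>) * (SUP y\<in>marginal_polytope n m w C. F y)"
    using asm by (intro mult_right_mono opt_nonneg[OF ij(1,2,4)]) auto
  then show "\<exists>x. fractional_local_search n m v \<sigma> knapsack \<epsilon> = Some x \<and>
             x \<in> config_polytope n m w C \<and>
             F (marginals m w C x) \<ge> (1 - 3 / real n) * (SUP y\<in>marginal_polytope n m w C. F y)"
    using search_approximates[OF ij] by (meson order_trans)
qed

end
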